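(* Let $F$ be a field of characteristic zero and let $\mathbb M=M_{1,1}(F)$ be the algebra of $2\times 2$ matrices over $F$ with its canonical $\mathbb Z_2$-grading and the transpose superinvolution. Let $W$ be the $T_2^*$-subspace of $\mathcal F$ generated by $y_{1,0}$ together with all polynomials in $Id^*(\mathbb M)$. Then the set $Id^{*,z}(\mathbb M)$ of central $*$-polynomials of $\mathbb M$ equals $W$.
   Context: A superalgebra is an associative $F$-algebra $A=A^{(0)}\oplus A^{(1)}$ with $A^{(i)}A^{(j)}\subseteq A^{(i+j \bmod 2)}$; for homogeneous $a\in A^{(i)}$ write $|a|=i$. A superinvolution on $A$ is a linear map $*:A\to A$ with $(A^{(i)})^*=A^{(i)}$, $(a^* )^*=a$ for all $a$, and $(ab)^*=(-1)^{|a||b|}b^*a^*$ for homogeneous $a,b$. A superalgebra with superinvolution is called a $*$-algebra. Put $(A^{(i)})^{+}=\{a\in A^{(i)}:a^*=a\}$ and $(A^{(i)})^{-}=\{a\in A^{(i)}:a^*=-a\}$. $\mathbb M=M_{1,1}(F)$ is $M_2(F)$ with even part $\mathrm{span}\{e_{11},e_{22}\}$, odd part $\mathrm{span}\{e_{12},e_{21}\}$, and superinvolution $\begin{pmatrix}a&c\\d&b\end{pmatrix}^{*}=\begin{pmatrix}b&-c\\d&a\end{pmatrix}$. Thus $(\mathbb M^{(0)})^+=F(e_{11}+e_{22})$, $(\mathbb M^{(0)})^-=F(e_{11}-e_{22})$, $(\mathbb M^{(1)})^+=Fe_{21}$, $(\mathbb M^{(1)})^-=Fe_{12}$. Let $\mathcal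 F=F\langle X|*\rangle$ be the free associative algebra without unit (polynomials with zero constant term) on the non-commuting variables $y_{i,0},z_{i,0},y_{i,1},z_{i,1}$ ($i\ge 1$), graded by letting $y_{i,0},z_{i,0}$ have degree $0$ and $y_{i,1},z_{i,1}$ have degree $1$, with the superinvolution $*$ determined by $y_{i,j}^*=y_{i,j}$, $z_{i,j}^*=-z_{i,j}$. Elements of $\mathcal F$ are called $*$-polynomials. An admissible evaluation of $f\in\mathcal F$ in a $*$-algebra $A$ is a substitution of the variables $y_{i,0},z_{i,0},y_{i,1},z_{i,1}$ by elements of $(A^{(0)})^+,(A^{(0)})^-,(A^{(1)})^+,(A^{(1)})^-$ respectively. $f$ is a $*$-identity of $A$ if all its admissible evaluations are $0$, and a central $*$-polynomial of $A$ if all its admissible evaluations lie in the center of $A$ (the constant term being zero by convention). $Id^*(A)$ and $Id^{*,z}(A)$ denote the sets of $*$-identities and of central $*$-polynomials of $A$. A $T_2^*$-subspace of $\mathcal F$ is a linear subspace invariant under all graded (degree-preserving) algebra endomorphisms of $\mathcal F$ commuting with $*$; the $T_2^*$-subspace generated by $S\subseteq\mathcal F$ is the smallest $T_2^*$-subspace containing $S$. *)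

theory Defs
  imports "HOL-Analysis.Analysis" "HOL-Library.Poly_Mapping" "HOL-Library.Z2"
begin

section \<open>Superalgebras with superinvolution\<close>

text \<open>
  The grading group is the two-element field \<^typ>\<open>bit\<close>.  The addition is that of the type
  \<open>'a\<close>; the algebra itself is the sum \<open>alg_carrier A\<close> of the two homogeneous components, which may
  be a proper subspace of \<open>'a\<close>, and no unit is required.
\<close>

record ('f, 'a) superalg =
  scl :: "'f \<Rightarrow> 'a \<Rightarrow> 'a"
  mul :: "'a \<Rightarrow> 'a \<Rightarrow> 'a"
  part :: "bit \<Rightarrow> 'a set"
  sinv :: "'a \<Rightarrow> 'a"

definition alg_carrier :: "('f, 'a::ab_group_add) superalg \<Rightarrow> 'a set" where
  "alg_carrier A = {a + b | a b. a \<in> part A 0 \<and> b \<in> part A 1}"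

text \<open>\<open>super_sign i j\<close> is $(-1)^{ij}$.\<close>

definition super_sign :: "bit \<Rightarrow> bit \<Rightarrow> 'f::ring_1" where
  "super_sign i j = (if i = 1 \<and> j = 1 then - 1 else 1)"

locale star_algebra =
  fixes A :: "('f::field, 'a::ab_group_add) superalg"
  assumes vector_space: "vector_space (scl A)"
    and part_subspace: "module.subspace (scl A) (part A i)"
    and part_Int: "part A 0 \<inter> part A 1 = {0}"
    and mul_add_left: "\<lbrakk>a \<in> alg_carrier A; b \<in> alg_carrier A; c \<in> alg_carrier A\<rbrakk>
          \<Longrightarrow> mul A (a + b) c = mul A a c + mul A b c"
    and mul_add_right: "\<lbrakk>a \<in> alg_carrier A; b \<in> alg_carrier A; c \<in> alg_carrier A\<rbrakk>
          \<Longrightarrow> mul A a (b + c) = mul A a b + mul A a c"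
    and mul_scl_left: "\<lbrakk>a \<in> alg_carrier A; b \<in> alg_carrier A\<rbrakk>
          \<Longrightarrow> mul A (scl A k a) b = scl A k (mul A a b)"
    and mul_scl_right: "\<lbrakk>a \<in> alg_carrier A; b \<in> alg_carrier A\<rbrakk>
          \<Longrightarrow> mul A a (scl A k b) = scl A k (mul A a b)"
    and mul_assoc: "\<lbrakk>a \<in> alg_carrier A; b \<in> alg_carrier A; c \<in> alg_carrier A\<rbrakk>
          \<Longrightarrow> mul A (mul A a b) c = mul A a (mul A b c)"
    and mul_part: "\<lbrakk>a \<in> part A i; b \<in> part A j\<rbrakk> \<Longrightarrow> mul A a b \<in> part A (i + j)"
    and sinv_add: "\<lbrakk>a \<in> alg_carrier A; b \<in> alg_carrier A\<rbrakk>
          \<Longrightarrow> sinv A (a + b) = sinv A a + sinv A b"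
    and sinv_scl: "a \<in> alg_carrier A \<Longrightarrow> sinv A (scl A k a) = scl A k (sinv A a)"
    and sinv_part: "sinv A ` part A i = part A i"
    and sinv_sinv: "a \<in> alg_carrier A \<Longrightarrow> sinv A (sinv A a) = a"
    and sinv_mul: "\<lbrakk>a \<in> part A i; b \<in> part A j\<rbrakk>
          \<Longrightarrow> sinv A (mul A a b) = scl A (super_sign i j) (mul A (sinv A b) (sinv A a))"

definition sym_part :: "('f, 'a) superalg \<Rightarrow> bit \<Rightarrow> 'a set" where
  "sym_part A i = {a \<in> part A i. sinv A a = a}"

definition skew_part :: "('f, 'a::ab_group_add) superalg \<Rightarrow> bit \<Rightarrow> 'a set" where
  "skew_part A i = {a \<in> part A i. sinv A a = - a}"

definition alg_center :: "('f, 'a::ab_group_add) superalg \<Rightarrow> 'a set" where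
  "alg_center A = {c \<in> alg_carrier A. \<forall>a \<in> alg_carrier A. mul A c a = mul A a c}"

text \<open>Graded algebra homomorphisms commuting with the superinvolutions.  Only the values on the
  carrier matter.\<close>

definition star_hom ::
  "('f, 'a::ab_group_add) superalg \<Rightarrow> ('f, 'b::ab_group_add) superalg \<Rightarrow> ('a \<Rightarrow> 'b) \<Rightarrow> bool" where
  "star_hom A B h \<longleftrightarrow>
     (\<forall>a \<in> alg_carrier A. \<forall>b \<in> alg_carrier A. h (a + b) = h a + h b) \<and>
     (\<forall>k. \<forall>a \<in> alg_carrier A. h (scl A k a) = scl B k (h a)) \<and>
     (\<forall>a \<in> alg_carrier A. \<forall>b \<in> alg_carrier A. h (mul A a b) = mul B (h a) (h b)) \<and>
     (\<forall>i. h ` part A i \<subseteq> part B i) \<and>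
     (\<forall>a \<in> alg_carrier A. h (sinv A a) = sinv B (h a))"

section \<open>The algebra $M_{1,1}(F)$ with its transpose superinvolution\<close>

definition M11 :: "('f::field, 'f^2^2) superalg" where
  "M11 = \<lparr> scl = (\<lambda>k. map_matrix ((*) k)),
           mul = (**),
           part = (\<lambda>i. if i = 0 then {X. X$1$2 = 0 \<and> X$2$1 = 0} else {X. X$1$1 = 0 \<and> X$2$2 = 0}),
           sinv = (\<lambda>X. vector [vector [X$2$2, - X$1$2], vector [X$2$1, X$1$1]]) \<rparr>"

lemma alg_carrier_M11: "alg_carrier M11 = UNIV"
proof -
  have "\<exists>a b. X = a + b \<and> a \<in> part M11 0 \<and> b \<in> part M11 1" for X :: "'a^2^2"
    by (rule exI[of _ "vector [vector [X$1$1, 0], vector [0, X$2$2]]"],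
        rule exI[of _ "vector [vector [0, X$1$2], vector [X$2$1, 0]]"])
       (simp add: M11_def vec_eq_iff forall_2)
  then show ?thesis by (auto simp: alg_carrier_def)
qed

lemma M11_parts:
  "sym_part M11 0 = {X :: ('f::field_char_0)^2^2. \<exists>c. X = vector [vector [c, 0], vector [0, c]]}"
  "skew_part M11 0 = {X :: 'f^2^2. \<exists>c. X = vector [vector [c, 0], vector [0, - c]]}"
  "sym_part M11 1 = {X :: 'f^2^2. \<exists>c. X = vector [vector [0, 0], vector [c, 0]]}"
  "skew_part M11 1 = {X :: 'f^2^2. \<exists>c. X = vector [vector [0, c], vector [0, 0]]}"
  by (auto simp: sym_part_def skew_part_def M11_def vec_eq_iff forall_2)

lemma star_algebra_M11: "star_algebra (M11 :: ('f::field, 'f^2^2) superalg)"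
proof -
  have vs: "vector_space (scl (M11 :: ('f, 'f^2^2) superalg))"
    by unfold_locales (simp_all add: M11_def vec_eq_iff algebra_simps)
  then have md: "module (scl (M11 :: ('f, 'f^2^2) superalg))"
    by (simp add: vector_space_def module_def)
  have surj: "X \<in> sinv M11 ` part M11 i" if "X \<in> part M11 i" for X :: "'f^2^2" and i
    by (rule image_eqI[of _ _ "sinv M11 X"], insert that)
       (auto simp: M11_def vec_eq_iff forall_2 split: if_splits)
  show ?thesis
  proof
    show "module.subspace (scl M11) (part (M11 :: ('f, 'f^2^2) superalg) i)" for i
      unfolding module.subspace_def[OF md] by (auto simp: M11_def)
    show "sinv M11 ` part M11 i = part (M11 :: ('f, 'f^2^2) superalg) i" for i
    proof
      show "sinv M11 ` part M11 i \<subseteq> part (M11 :: ('f, 'f^2^2) superalg) i"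
        by (auto simp: M11_def)
      show "part M11 i \<subseteq> sinv M11 ` part (M11 :: ('f, 'f^2^2) superalg) i"
        using surj by blast
    qed
    show "mul M11 a b \<in> part M11 (i + j)" if "a \<in> part M11 i" "b \<in> part M11 j"
      for a b :: "'f^2^2" and i j
      using that by (cases i; cases j) (auto simp: M11_def matrix_matrix_mult_def sum_2)
    show "sinv M11 (mul M11 a b) =
        scl M11 (super_sign i j) (mul M11 (sinv M11 b) (sinv M11 a))"
      if "a \<in> part M11 i" "b \<in> part M11 j" for a b :: "'f^2^2" and i j
      using that by (cases i; cases j)
        (auto simp: M11_def matrix_matrix_mult_def sum_2 super_sign_def vec_eq_iff forall_2)
  qed (auto simp: vs M11_def vec_eq_iff forall_2 matrix_matrix_mult_def sum_2 algebra_simps)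
qed

section \<open>The free algebra with superinvolution\<close>

text \<open>The indices start at \<open>0\<close>: \<open>Y i j\<close> and \<open>Z i j\<close> stand for $y_{i+1,j}$ and $z_{i+1,j}$.\<close>

datatype var = Y nat bit | Z nat bit

primrec var_deg :: "var \<Rightarrow> bit" where
  "var_deg (Y i j) = j"
| "var_deg (Z i j) = j"

primrec var_sign :: "var \<Rightarrow> 'f::ring_1" where
  "var_sign (Y i j) = 1"
| "var_sign (Z i j) = - 1"

definition word_deg :: "var list \<Rightarrow> bit" where
  "word_deg w = sum_list (map var_deg w)"

text \<open>The words form a monoid under concatenation, so that \<^typ>\<open>var list \<Rightarrow>\<^sub>0 'f\<close>, with its library
  multiplication, is the free associative algebra with unit.  The algebra \<open>free_alg\<close> below is its
  ideal of polynomials with zero constant term.\<close>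

instantiation list :: (type) monoid_add
begin

definition zero_list :: "'a list" where "zero_list = []"

definition plus_list :: "'a list \<Rightarrow> 'a list \<Rightarrow> 'a list" where "plus_list = (@)"

instance
  by standard (simp_all add: zero_list_def plus_list_def)

end

text \<open>\<open>star_sign w\<close> is the sign in $w^* = \pm\, \mathrm{rev}(w)$, obtained from
  $(x w)^* = (-1)^{|x||w|} w^* x^*$.\<close>

primrec star_sign :: "var list \<Rightarrow> 'f::ring_1" where
  "star_sign [] = 1"
| "star_sign (x # w) = super_sign (var_deg x) (word_deg w) * var_sign x * star_sign w"

definition free_alg :: "('f::field, var list \<Rightarrow>\<^sub>0 'f) superalg" where
  "free_alg = \<lparr> scl = (\<lambda>k. Poly_Mapping.map ((*) k)),
                mul = (*),
                part = (\<lambda>i. {f. \<forall>w \<in> Poly_Mapping.keys f. w \<noteq> [] \<and> word_deg w = i}),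
                sinv = (\<lambda>f. \<Sum>w \<in> Poly_Mapping.keys f.
                          Poly_Mapping.single (rev w) (star_sign w * Poly_Mapping.lookup f w)) \<rparr>"

definition var_poly :: "var \<Rightarrow> var list \<Rightarrow>\<^sub>0 'f::field" where
  "var_poly x = Poly_Mapping.single [x] 1"

lemma super_sign_add_left:
  "super_sign (i + j) k = (super_sign i k * super_sign j k :: 'f::ring_1)"
  by (cases i; cases j; cases k) (simp_all add: super_sign_def)

lemma super_sign_add_right:
  "super_sign k (i + j) = (super_sign k i * super_sign k j :: 'f::ring_1)"
  by (cases i; cases j; cases k) (simp_all add: super_sign_def)

lemma super_sign_commute: "super_sign i j = super_sign j i"
  by (auto simp: super_sign_def)

lemma word_deg_simps [simp]:
  "word_deg [] = 0" "word_deg (x # w) = var_deg x + word_deg w"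
  "word_deg (u @ v) = word_deg u + word_deg v" "word_deg (rev w) = word_deg w"
  by (simp_all add: word_deg_def sum_list_rev flip: rev_map)

lemma star_sign_append:
  "star_sign (u @ v) =
     (super_sign (word_deg u) (word_deg v) * star_sign u * star_sign v :: 'f::field)"
  by (induction u) (simp_all add: super_sign_add_left super_sign_add_right super_sign_def)

lemma star_sign_rev: "star_sign (rev w) = (star_sign w :: 'f::field)"
  by (induction w) (simp_all add: star_sign_append super_sign_commute super_sign_def)

lemma star_sign_square: "star_sign w * star_sign w = (1 :: 'f::field)"
proof (induction w)
  case (Cons x w)
  have "var_sign x * var_sign x = (1 :: 'f)" by (cases x) simp_all
  then show ?case using Cons by (simp add: super_sign_def algebra_simps)
qed simp

lemma lookup_scl_free: "Poly_Mapping.lookup (scl free_alg k f) w = k * Poly_Mapping.lookup f w"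
  by (simp add: free_alg_def Poly_Mapping.map.rep_eq when_def)

lemma lookup_sinv_free:
  "Poly_Mapping.lookup (sinv free_alg f) w =
     star_sign w * Poly_Mapping.lookup (f :: var list \<Rightarrow>\<^sub>0 'f::field) (rev w)"
proof -
  have "Poly_Mapping.lookup (sinv free_alg f) w =
      (\<Sum>v \<in> Poly_Mapping.keys f. if v = rev w then star_sign v * Poly_Mapping.lookup f v else 0)"
    unfolding free_alg_def superalg.simps lookup_sum
    by (rule sum.cong) (auto simp: lookup_single when_def)
  also have "\<dots> = star_sign w * Poly_Mapping.lookup f (rev w)"
    by (simp only: sum.delta finite_keys) (auto simp: star_sign_rev in_keys_iff)
  finally show ?thesis .
qed

lemma alg_carrier_free:
  "alg_carrier free_alg =
     {f :: var list \<Rightarrow>\<^sub>0 'f::field. Poly_Mapping.lookup f [] = 0}"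
proof (intro set_eqI iffI)
  fix f :: "var list \<Rightarrow>\<^sub>0 'f" assume "f \<in> alg_carrier free_alg"
  then show "f \<in> {f. Poly_Mapping.lookup f [] = 0}"
  proof -
    obtain a b where "f = a + b" "[] \<notin> Poly_Mapping.keys a" "[] \<notin> Poly_Mapping.keys b"
      using \<open>f \<in> alg_carrier free_alg\<close> unfolding alg_carrier_def free_alg_def by fastforce
    then show ?thesis by (simp add: lookup_add in_keys_iff)
  qed
next
  fix f :: "var list \<Rightarrow>\<^sub>0 'f" assume f: "f \<in> {f. Poly_Mapping.lookup f [] = 0}"
  define g where "g i = Poly_Mapping.mapp (\<lambda>w c. c when word_deg w = i) f" for i
  have lg: "Poly_Mapping.lookup (g i) w = (Poly_Mapping.lookup f w when word_deg w = i)" for i w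
    by (auto simp: g_def mapp.rep_eq when_def in_keys_iff)
  have "f = g 0 + g 1"
    by (rule poly_mapping_eqI) (auto simp: lookup_add lg when_def)
  moreover have "g i \<in> part free_alg i" for i
    using f by (auto simp: free_alg_def in_keys_iff lg when_def split: if_splits)
  ultimately show "f \<in> alg_carrier free_alg" unfolding alg_carrier_def by blast
qed

lemma poly_sum_single:
  "f = (\<Sum>w \<in> Poly_Mapping.keys f. Poly_Mapping.single w (Poly_Mapping.lookup f w))"
proof (rule poly_mapping_eqI)
  fix k
  have "Poly_Mapping.lookup
      (\<Sum>w \<in> Poly_Mapping.keys f. Poly_Mapping.single w (Poly_Mapping.lookup f w)) k =
      (\<Sum>w \<in> Poly_Mapping.keys f. if k = w then Poly_Mapping.lookup f w else 0)"
    by (auto simp: lookup_sum lookup_single when_def intro!: sum.cong)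
  then show "Poly_Mapping.lookup f k = Poly_Mapping.lookup
      (\<Sum>w \<in> Poly_Mapping.keys f. Poly_Mapping.single w (Poly_Mapping.lookup f w)) k"
    by (simp add: in_keys_iff)
qed

lemma sinv_free_add: "sinv free_alg (f + g) = sinv free_alg f + sinv free_alg g"
  by (rule poly_mapping_eqI) (simp add: lookup_sinv_free lookup_add algebra_simps)

lemma sinv_free_sum: "sinv free_alg (sum f I) = (\<Sum>i \<in> I. sinv free_alg (f i))"
  by (rule poly_mapping_eqI) (simp add: lookup_sinv_free lookup_sum sum_distrib_left)

lemma sinv_free_single:
  "sinv free_alg (Poly_Mapping.single w c) = Poly_Mapping.single (rev w) (star_sign w * c)"
  by (rule poly_mapping_eqI)
     (auto simp: lookup_sinv_free lookup_single when_def star_sign_rev)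

lemma sinv_var_poly:
  "sinv free_alg (var_poly (Y i j)) = var_poly (Y i j)"
  "sinv free_alg (var_poly (Z i j)) = - var_poly (Z i j)"
  by (simp_all add: var_poly_def sinv_free_single super_sign_def single_uminus)

lemma sinv_free_mult:
  fixes f g :: "var list \<Rightarrow>\<^sub>0 'f::field"
  assumes "f \<in> part free_alg i" and "g \<in> part free_alg j"
  shows "sinv free_alg (f * g) =
    scl free_alg (super_sign i j) (sinv free_alg g * sinv free_alg f)"
proof -
  let ?s = "Poly_Mapping.single" and ?l = "Poly_Mapping.lookup"
  let ?F = "Poly_Mapping.keys f" and ?G = "Poly_Mapping.keys g"
  have scl_sum: "scl free_alg k (\<Sum>x \<in> I. h x) = (\<Sum>x \<in> I. scl free_alg k (h x))"
    for k and I :: "var list set" and h :: "var list \<Rightarrow> var list \<Rightarrow>\<^sub>0 'f"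
    by (rule poly_mapping_eqI) (simp add: lookup_scl_free lookup_sum sum_distrib_left)
  have scl_single: "scl free_alg k (?s w c) = ?s w (k * c)" for k c :: 'f and w
    by (rule poly_mapping_eqI) (simp add: lookup_scl_free lookup_single when_def)
  have deg: "word_deg u = i" "word_deg v = j" if "u \<in> ?F" "v \<in> ?G" for u v
    using assms that by (auto simp: free_alg_def)
  have "f * g = (\<Sum>u \<in> ?F. ?s u (?l f u)) * (\<Sum>v \<in> ?G. ?s v (?l g v))"
    using poly_sum_single[of f] poly_sum_single[of g] by simp
  also have "\<dots> = (\<Sum>u \<in> ?F. \<Sum>v \<in> ?G. ?s (u @ v) (?l f u * ?l g v))"
    by (simp add: sum_product mult_single plus_list_def)
  finally have "sinv free_alg (f * g) =
      (\<Sum>u \<in> ?F. \<Sum>v \<in> ?G. ?s (rev v @ rev u) (star_sign (u @ v) * (?l f u * ?l g v)))"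
    by (simp add: sinv_free_sum sinv_free_single)
  also have "\<dots> = (\<Sum>u \<in> ?F. \<Sum>v \<in> ?G. scl free_alg (super_sign i j)
      (?s (rev v) (star_sign v * ?l g v) * ?s (rev u) (star_sign u * ?l f u)))"
    by (intro sum.cong refl)
       (simp add: mult_single plus_list_def scl_single star_sign_append deg mult_ac)
  also have "\<dots> = (\<Sum>v \<in> ?G. \<Sum>u \<in> ?F. scl free_alg (super_sign i j)
      (?s (rev v) (star_sign v * ?l g v) * ?s (rev u) (star_sign u * ?l f u)))"
    by (rule sum.swap)
  also have "\<dots> = scl free_alg (super_sign i j)
      ((\<Sum>v \<in> ?G. ?s (rev v) (star_sign v * ?l g v)) *
       (\<Sum>u \<in> ?F. ?s (rev u) (star_sign u * ?l f u)))"
    by (simp add: sum_product scl_sum)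
  also have "\<dots> = scl free_alg (super_sign i j) (sinv free_alg g * sinv free_alg f)"
    by (simp add: free_alg_def)
  finally show ?thesis .
qed

lemma star_algebra_free: "star_algebra (free_alg :: ('f::field, var list \<Rightarrow>\<^sub>0 'f) superalg)"
proof -
  let ?A = "free_alg :: ('f, var list \<Rightarrow>\<^sub>0 'f) superalg"
  have vs: "vector_space (scl ?A)"
    unfolding vector_space_def
    by (intro conjI allI poly_mapping_eqI; simp add: lookup_scl_free lookup_add algebra_simps)
  then have md: "module (scl ?A)"
    by (simp add: vector_space_def module_def)
  have mul: "mul ?A = (*)" by (simp add: free_alg_def)
  have scl: "scl ?A k f = Poly_Mapping.single 0 k * f" for k f
  proof -
    have "Poly_Mapping.single 0 k * f = (\<Sum>w \<in> Poly_Mapping.keys f.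
        Poly_Mapping.single w (k * Poly_Mapping.lookup f w))"
      by (subst poly_sum_single[of f]) (simp only: sum_distrib_left mult_single add_0_left)
    also have "\<dots> = (\<Sum>w \<in> Poly_Mapping.keys f.
        scl ?A k (Poly_Mapping.single w (Poly_Mapping.lookup f w)))"
      by (intro sum.cong refl poly_mapping_eqI) (simp add: lookup_scl_free lookup_single when_def)
    also have "\<dots> = scl ?A k (\<Sum>w \<in> Poly_Mapping.keys f.
        Poly_Mapping.single w (Poly_Mapping.lookup f w))"
      by (rule poly_mapping_eqI) (simp add: lookup_scl_free lookup_sum sum_distrib_left)
    also have "\<dots> = scl ?A k f"
      using poly_sum_single[of f] by simp
    finally show ?thesis by simp
  qed
  have inv: "sinv ?A (sinv ?A f) = f" for f
    by (rule poly_mapping_eqI)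
       (simp add: lookup_sinv_free star_sign_rev star_sign_square flip: mult.assoc)
  have sub: "sinv ?A f \<in> part ?A i" if "f \<in> part ?A i" for f i
  proof -
    have "w \<noteq> [] \<and> word_deg w = i" if "w \<in> Poly_Mapping.keys (sinv ?A f)" for w
    proof -
      have "rev w \<in> Poly_Mapping.keys f"
        using that by (auto simp: in_keys_iff lookup_sinv_free)
      then show ?thesis using \<open>f \<in> part ?A i\<close> by (auto simp: free_alg_def)
    qed
    then show ?thesis by (simp add: free_alg_def)
  qed
  have single_comm: "f * (Poly_Mapping.single 0 k * g) = Poly_Mapping.single 0 k * (f * g)"
    for f g and k :: 'f
  proof -
    have "f * Poly_Mapping.single 0 k = Poly_Mapping.single 0 k * f"
    proof -
      define g where "g = (\<Sum>w \<in> Poly_Mapping.keys f.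
        Poly_Mapping.single w (Poly_Mapping.lookup f w))"
      have "g * Poly_Mapping.single 0 k = Poly_Mapping.single 0 k * g"
        by (simp add: g_def sum_distrib_left sum_distrib_right mult_single mult.commute)
      then show ?thesis using poly_sum_single[of f] by (simp add: g_def)
    qed
    then show ?thesis by (metis mult.assoc)
  qed
  show ?thesis
  proof (rule star_algebra.intro)
    show "module.subspace (scl ?A) (part ?A i)" for i
      unfolding module.subspace_def[OF md]
    proof (intro conjI ballI allI)
      show "0 \<in> part ?A i" by (simp add: free_alg_def)
      show "f + g \<in> part ?A i" if "f \<in> part ?A i" "g \<in> part ?A i" for f g
        using that Poly_Mapping.keys_add[of f g] by (auto simp: free_alg_def)
      show "scl ?A k f \<in> part ?A i" if "f \<in> part ?A i" for k f
      proof -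
        have "Poly_Mapping.keys (scl ?A k f) \<subseteq> Poly_Mapping.keys f"
          by (auto simp: in_keys_iff lookup_scl_free)
        then show ?thesis using that by (auto simp: free_alg_def)
      qed
    qed
    show "part ?A 0 \<inter> part ?A 1 = {0}"
    proof -
      have "f = 0" if "f \<in> part ?A 0 \<inter> part ?A 1" for f
      proof -
        have "Poly_Mapping.keys f = {}" using that by (force simp: free_alg_def)
        then show ?thesis by simp
      qed
      moreover have "0 \<in> part ?A 0 \<inter> part ?A 1" by (simp add: free_alg_def)
      ultimately show ?thesis by blast
    qed
    show "mul ?A f g \<in> part ?A (i + j)" if "f \<in> part ?A i" "g \<in> part ?A j" for f g i j
    proof -
      have "Poly_Mapping.keys (f * g) \<subseteq>
          {u + v | u v. u \<in> Poly_Mapping.keys f \<and> v \<in> Poly_Mapping.keys g}"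
        by (rule keys_mult)
      then show ?thesis using that by (fastforce simp: free_alg_def plus_list_def)
    qed
    show "sinv ?A ` part ?A i = part ?A i" for i
      using sub inv by (metis (no_types, lifting) image_iff subsetI subset_antisym image_subsetI)
    show "sinv ?A (scl ?A k f) = scl ?A k (sinv ?A f)" for k f
      by (rule poly_mapping_eqI) (simp add: lookup_scl_free lookup_sinv_free)
    show "sinv ?A (mul ?A f g) = scl ?A (super_sign i j) (mul ?A (sinv ?A g) (sinv ?A f))"
      if "f \<in> part ?A i" "g \<in> part ?A j" for f g i j
      using sinv_free_mult[OF that] by (simp add: mul)
    show "mul ?A (scl ?A k f) g = scl ?A k (mul ?A f g)" for k f g
      by (simp add: mul scl mult.assoc)
    show "mul ?A f (scl ?A k g) = scl ?A k (mul ?A f g)" for k f g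
      by (simp add: mul scl single_comm)
  qed (simp_all add: vs inv sinv_free_add mul algebra_simps)
qed

section \<open>Identities and central polynomials\<close>

text \<open>As \<open>A\<close> need not have a unit, the empty word has no value; the first equation is a dummy,
  irrelevant for elements of \<open>free_alg\<close>.\<close>

fun eval_word :: "('f, 'a::ab_group_add) superalg \<Rightarrow> (var \<Rightarrow> 'a) \<Rightarrow> var list \<Rightarrow> 'a" where
  "eval_word A s [] = 0"
| "eval_word A s [x] = s x"
| "eval_word A s (x # y # w) = mul A (s x) (eval_word A s (y # w))"

definition eval_poly ::
  "('f::field, 'a::ab_group_add) superalg \<Rightarrow> (var \<Rightarrow> 'a) \<Rightarrow> (var list \<Rightarrow>\<^sub>0 'f) \<Rightarrow> 'a" where
  "eval_poly A s f =
     (\<Sum>w \<in> Poly_Mapping.keys f. scl A (Poly_Mapping.lookup f w) (eval_word A s w))"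

definition admissible :: "('f, 'a::ab_group_add) superalg \<Rightarrow> (var \<Rightarrow> 'a) \<Rightarrow> bool" where
  "admissible A s \<longleftrightarrow> (\<forall>i j. s (Y i j) \<in> sym_part A j \<and> s (Z i j) \<in> skew_part A j)"

definition star_identities ::
  "('f::field, 'a::ab_group_add) superalg \<Rightarrow> (var list \<Rightarrow>\<^sub>0 'f) set" where
  "star_identities A =
     {f \<in> alg_carrier free_alg. \<forall>s. admissible A s \<longrightarrow> eval_poly A s f = 0}"

definition central_star_polynomials ::
  "('f::field, 'a::ab_group_add) superalg \<Rightarrow> (var list \<Rightarrow>\<^sub>0 'f) set" where
  "central_star_polynomials A =
     {f \<in> alg_carrier free_alg. \<forall>s. admissible A s \<longrightarrow> eval_poly A s f \<in> alg_center A}"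

definition T2_star_subspace :: "(var list \<Rightarrow>\<^sub>0 'f::field) set \<Rightarrow> bool" where
  "T2_star_subspace V \<longleftrightarrow>
     V \<subseteq> alg_carrier free_alg \<and>
     module.subspace (scl free_alg) V \<and>
     (\<forall>h. star_hom free_alg free_alg h \<longrightarrow> h ` V \<subseteq> V)"

end

theory Submission
  imports Defs
begin

text \<open>
  The center of \<open>M11\<close> is exactly its even symmetric part.  If \<open>f = a + b\<close> is central, with \<open>a\<close> even
  and \<open>b\<close> odd, then on every admissible evaluation \<open>b\<close> vanishes and \<open>a\<close> agrees with its symmetrization
  \<open>p = (a + a\<^sup>*) / 2\<close>.  So \<open>f - p\<close> is an identity, while \<open>p\<close>, being even and symmetric, is the image
  of $y_{1,0}$ under an endomorphism of the free algebra.
\<close>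

section \<open>Closure of the carrier and linearity of the operations on finite sums\<close>

context star_algebra
begin

interpretation vs: vector_space "scl A" by (rule vector_space)

lemma zero_part: "0 \<in> part A i"
  by (rule vs.subspace_0[OF part_subspace])

lemma part_carrier: "a \<in> part A i \<Longrightarrow> a \<in> alg_carrier A"
  unfolding alg_carrier_def using zero_part[of 0] zero_part[of 1]
  by (cases i) (force intro: exI[of _ a] exI[of _ 0])+

lemma subspace_carrier: "vs.subspace (alg_carrier A)"
  using vs.subspace_sums[OF part_subspace[of 0] part_subspace[of 1]]
  by (simp add: alg_carrier_def)

text \<open>The axiom \<open>mul_part\<close> covers homogeneous factors only, so both factors are
  split into even and odd components and the four resulting products are added up.\<close>

lemma mul_carrier:
  assumes "a \<in> alg_carrier A" "b \<in> alg_carrier A"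
  shows "mul A a b \<in> alg_carrier A"
proof -
  obtain a0 a1 b0 b1 where ab: "a = a0 + a1" "b = b0 + b1"
    and p: "a0 \<in> part A 0" "a1 \<in> part A 1" "b0 \<in> part A 0" "b1 \<in> part A 1"
    using assms unfolding alg_carrier_def by blast
  note c = p[THEN part_carrier]
  have m: "mul A u v \<in> alg_carrier A" if "u \<in> part A i" "v \<in> part A j" for u v i j
    using mul_part[OF that] by (rule part_carrier)
  have s: "b0 + b1 \<in> alg_carrier A"
    using assms ab by simp
  show ?thesis
    unfolding ab
    by (simp add: mul_add_left mul_add_right c s)
      (intro vs.subspace_add[OF subspace_carrier] m[OF p(1) p(3)] m[OF p(1) p(4)]
        m[OF p(2) p(3)] m[OF p(2) p(4)])
qed

lemma mul_zero:
  assumes "a \<in> alg_carrier A"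
  shows "mul A 0 a = 0" "mul A a 0 = 0"
  using mul_scl_left[OF assms assms, of 0] mul_scl_right[OF assms assms, of 0] by simp_all

lemma sinv_zero: "sinv A 0 = 0"
  using sinv_scl[OF vs.subspace_0[OF subspace_carrier], of 0] by simp

text \<open>Additivity of \<open>mul\<close> holds only inside the carrier, hence each induction
  step first places the partial sum there; the right factor is expanded first, then the left
  one.\<close>

lemma mul_sum:
  assumes "finite I" "finite J"
    and "\<And>i. i \<in> I \<Longrightarrow> f i \<in> alg_carrier A" "\<And>j. j \<in> J \<Longrightarrow> g j \<in> alg_carrier A"
  shows "mul A (\<Sum>i\<in>I. f i) (\<Sum>j\<in>J. g j) = (\<Sum>i\<in>I. \<Sum>j\<in>J. mul A (f i) (g j))"
proof -
  have gJ: "(\<Sum>j\<in>J. g j) \<in> alg_carrier A"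
    by (rule vs.subspace_sum[OF subspace_carrier]) (use assms in auto)
  have right: "mul A u (\<Sum>j\<in>J. g j) = (\<Sum>j\<in>J. mul A u (g j))" if "u \<in> alg_carrier A" for u
    using \<open>finite J\<close> assms(4)
  proof (induction J)
    case (insert j J)
    have "(\<Sum>j\<in>J. g j) \<in> alg_carrier A"
      by (rule vs.subspace_sum[OF subspace_carrier]) (use insert in auto)
    then show ?case using insert that by (simp add: mul_add_right)
  qed (use that in \<open>simp add: mul_zero\<close>)
  show ?thesis
    using \<open>finite I\<close> assms(3)
  proof (induction I)
    case (insert i I)
    have "(\<Sum>i\<in>I. f i) \<in> alg_carrier A"
      by (rule vs.subspace_sum[OF subspace_carrier]) (use insert in auto)
    then show ?case using insert gJ by (simp add: mul_add_left right)
  qed (use gJ in \<open>simp add: mul_zero\<close>)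
qed

lemma sinv_sum:
  assumes "finite I" "\<And>i. i \<in> I \<Longrightarrow> f i \<in> alg_carrier A"
  shows "sinv A (\<Sum>i\<in>I. f i) = (\<Sum>i\<in>I. sinv A (f i))"
  using assms
proof (induction I)
  case (insert i I)
  have "(\<Sum>i\<in>I. f i) \<in> alg_carrier A"
    by (rule vs.subspace_sum[OF subspace_carrier]) (use insert in auto)
  then show ?case using insert by (simp add: sinv_add)
qed (simp add: sinv_zero)

section \<open>Evaluation of words\<close>

text \<open>Encoding symmetric and skew values by the scalar \<open>var_sign x\<close> lets later
  arguments treat \<open>Y\<close> and \<open>Z\<close> variables together.\<close>

lemma admissible_var:
  assumes "admissible A s"
  shows "s x \<in> part A (var_deg x)" "sinv A (s x) = scl A (var_sign x) (s x)"
  using assms by (cases x; auto simp: admissible_def sym_part_def skew_part_def)+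

lemma eval_word_part:
  assumes "admissible A s" "w \<noteq> []"
  shows "eval_word A s w \<in> part A (word_deg w)"
  using assms(2)
proof (induction w rule: induct_list012)
  case (3 x y w)
  have "eval_word A s (y # w) \<in> part A (word_deg (y # w))" using 3 by blast
  from mul_part[OF admissible_var(1)[OF assms(1), of x] this] show ?case
    by (simp only: eval_word.simps(3) word_deg_simps(2))
next
  case (2 x)
  show ?case
    using admissible_var(1)[OF assms(1), of x]
    by (simp only: eval_word.simps(2) word_deg_simps add_0_right)
qed simp

lemma eval_word_carrier: "admissible A s \<Longrightarrow> eval_word A s w \<in> alg_carrier A"
  using eval_word_part part_carrier zero_part by (cases "w = []") auto

lemma eval_word_Cons: "w \<noteq> [] \<Longrightarrow> eval_word A s (x # w) = mul A (s x) (eval_word A s w)"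
  by (cases w) auto

text \<open>Both words are nonempty because the value of \<open>[]\<close> is the dummy
  \<open>0\<close> and not a unit.\<close>

lemma eval_word_append:
  assumes "admissible A s" "u \<noteq> []" "v \<noteq> []"
  shows "eval_word A s (u @ v) = mul A (eval_word A s u) (eval_word A s v)"
  using assms(2)
proof (induction u)
  case (Cons x u)
  show ?case
  proof (cases "u = []")
    case False
    then show ?thesis
      using Cons assms(3)
      by (simp add: eval_word_Cons mul_assoc eval_word_carrier[OF assms(1)]
          part_carrier[OF admissible_var(1)[OF assms(1)]])
  qed (use assms in \<open>simp add: eval_word_Cons\<close>)
qed simp

text \<open>Induction on the word: the recursion of \<open>star_sign\<close> is the rule for the
  superinvolution of a product whose left factor is one variable, and reversal moves that variable
  to the end.\<close>

lemma sinv_eval_word: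
  assumes "admissible A s"
  shows "sinv A (eval_word A s w) = scl A (star_sign w) (eval_word A s (rev w))"
proof (induction w)
  case (Cons x w)
  show ?case
  proof (cases "w = []")
    case True
    then show ?thesis
      using admissible_var[OF assms] by (simp add: super_sign_def)
  next
    case False
    \<comment> \<open>Pulling scalars out of \<open>mul\<close> is allowed only for factors in the
      carrier.\<close>
    have "scl A c (eval_word A s v) \<in> alg_carrier A" for c v
      by (rule vs.subspace_scale[OF subspace_carrier eval_word_carrier[OF assms]])
    then have "sinv A (eval_word A s (x # w)) =
        scl A (super_sign (var_deg x) (word_deg w))
          (scl A (star_sign w) (scl A (var_sign x) (mul A (eval_word A s (rev w)) (s x))))"
      using False Cons assms
      by (simp add: eval_word_Cons sinv_mul[OF admissible_var(1) eval_word_part]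
          admissible_var(2) mul_scl_left mul_scl_right eval_word_carrier
          part_carrier[OF admissible_var(1)]
          vs.subspace_scale[OF subspace_carrier])
    then show ?thesis
      using False assms by (simp add: eval_word_append mult_ac)
  qed
qed (simp add: sinv_zero)

section \<open>Evaluation of polynomials as a homomorphism\<close>

text \<open>A common, larger index set makes polynomials with different supports comparable; words
  outside the support contribute zero.\<close>

lemma eval_poly_eq_sum:
  assumes "finite S" "Poly_Mapping.keys f \<subseteq> S"
  shows "eval_poly A s f = (\<Sum>w\<in>S. scl A (Poly_Mapping.lookup f w) (eval_word A s w))"
  unfolding eval_poly_def
  by (rule sum.mono_neutral_left) (use assms in \<open>auto simp: in_keys_iff\<close>)

lemma eval_poly_add: "eval_poly A s (f + g) = eval_poly A s f + eval_poly A s g"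
proof -
  let ?S = "Poly_Mapping.keys f \<union> Poly_Mapping.keys g"
  have e: "eval_poly A s h = (\<Sum>w\<in>?S. scl A (Poly_Mapping.lookup h w) (eval_word A s w))"
    if "Poly_Mapping.keys h \<subseteq> ?S" for h
    by (rule eval_poly_eq_sum) (use that in auto)
  show ?thesis
    using Poly_Mapping.keys_add[of f g]
    by (simp add: e lookup_add vs.scale_left_distrib sum.distrib)
qed

lemma eval_poly_scl: "eval_poly A s (scl free_alg k f) = scl A k (eval_poly A s f)"
proof -
  have "Poly_Mapping.keys (scl free_alg k f) \<subseteq> Poly_Mapping.keys f"
    by (auto simp: in_keys_iff lookup_scl_free)
  then have "eval_poly A s (scl free_alg k f) = (\<Sum>w\<in>Poly_Mapping.keys f.
      scl A (Poly_Mapping.lookup (scl free_alg k f) w) (eval_word A s w))"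
    by (intro eval_poly_eq_sum) auto
  then show ?thesis
    by (simp add: lookup_scl_free eval_poly_def vs.scale_sum_right)
qed

lemma eval_poly_single:
  "eval_poly A s (Poly_Mapping.single w c) = scl A c (eval_word A s w)"
  by (simp add: eval_poly_def)

lemma eval_poly_sum: "eval_poly A s (sum f I) = (\<Sum>i\<in>I. eval_poly A s (f i))"
  by (induction I rule: infinite_finite_induct)
    (simp_all add: eval_poly_add, simp_all add: eval_poly_def)

lemma eval_poly_carrier: "admissible A s \<Longrightarrow> eval_poly A s f \<in> alg_carrier A"
  unfolding eval_poly_def
  by (intro vs.subspace_sum[OF subspace_carrier] vs.subspace_scale[OF subspace_carrier]
      eval_word_carrier)

lemma eval_poly_part:
  assumes "admissible A s" "f \<in> part free_alg i"
  shows "eval_poly A s f \<in> part A i"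
  unfolding eval_poly_def
proof (intro vs.subspace_sum[OF part_subspace] vs.subspace_scale[OF part_subspace])
  fix w assume "w \<in> Poly_Mapping.keys f"
  then have "w \<noteq> []" "word_deg w = i" using assms(2) by (auto simp: free_alg_def)
  then show "eval_word A s w \<in> part A i" using eval_word_part[OF assms(1), of w] by simp
qed

text \<open>A zero constant term keeps the empty word out of both supports, so
  \<open>eval_word_append\<close> applies to each product of words and bilinearity does the
  rest.\<close>

lemma eval_poly_mult:
  assumes "admissible A s" "f \<in> alg_carrier free_alg" "g \<in> alg_carrier free_alg"
  shows "eval_poly A s (f * g) = mul A (eval_poly A s f) (eval_poly A s g)"
proof -
  let ?l = "Poly_Mapping.lookup" and ?F = "Poly_Mapping.keys f" and ?G = "Poly_Mapping.keys g"
  have ne: "w \<noteq> []" if "w \<in> ?F \<or> w \<in> ?G" for w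
    using that assms by (auto simp: alg_carrier_free in_keys_iff)
  have c: "scl A k (eval_word A s w) \<in> alg_carrier A" for k w
    by (rule vs.subspace_scale[OF subspace_carrier eval_word_carrier[OF assms(1)]])
  have "f * g = (\<Sum>u\<in>?F. Poly_Mapping.single u (?l f u)) * (\<Sum>v\<in>?G. Poly_Mapping.single v (?l g v))"
    using poly_sum_single[of f] poly_sum_single[of g] by simp
  also have "\<dots> = (\<Sum>u\<in>?F. \<Sum>v\<in>?G. Poly_Mapping.single (u @ v) (?l f u * ?l g v))"
    by (simp add: sum_product mult_single plus_list_def)
  finally have "eval_poly A s (f * g) =
      (\<Sum>u\<in>?F. \<Sum>v\<in>?G. scl A (?l f u * ?l g v) (eval_word A s (u @ v)))"
    by (simp add: eval_poly_sum eval_poly_single)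
  also have "\<dots> = (\<Sum>u\<in>?F. \<Sum>v\<in>?G.
      mul A (scl A (?l f u) (eval_word A s u)) (scl A (?l g v) (eval_word A s v)))"
    by (intro sum.cong refl)
      (simp add: ne eval_word_append[OF assms(1)] mul_scl_left mul_scl_right c
        eval_word_carrier[OF assms(1)])
  also have "\<dots> = mul A (eval_poly A s f) (eval_poly A s g)"
    by (simp add: eval_poly_def mul_sum c)
  finally show ?thesis .
qed

lemma eval_poly_sinv:
  assumes "admissible A s"
  shows "eval_poly A s (sinv free_alg f) = sinv A (eval_poly A s f)"
proof -
  let ?l = "Poly_Mapping.lookup" and ?F = "Poly_Mapping.keys f"
  have c: "scl A k (eval_word A s w) \<in> alg_carrier A" for k w
    by (rule vs.subspace_scale[OF subspace_carrier eval_word_carrier[OF assms]])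
  have "eval_poly A s (sinv free_alg f) =
      (\<Sum>w\<in>?F. scl A (star_sign w * ?l f w) (eval_word A s (rev w)))"
    by (simp add: free_alg_def eval_poly_sum eval_poly_single)
  also have "\<dots> = (\<Sum>w\<in>?F. sinv A (scl A (?l f w) (eval_word A s w)))"
    by (intro sum.cong refl)
      (simp add: sinv_scl eval_word_carrier[OF assms] sinv_eval_word[OF assms] mult.commute)
  also have "\<dots> = sinv A (eval_poly A s f)"
    by (simp add: eval_poly_def sinv_sum c)
  finally show ?thesis .
qed

text \<open>The existence half of the universal property of \<open>free_alg\<close>: every
  admissible substitution extends to a homomorphism.\<close>

lemma star_hom_eval_poly: "admissible A s \<Longrightarrow> star_hom free_alg A (eval_poly A s)"
  unfolding star_hom_def
  using eval_poly_add eval_poly_scl eval_poly_mult eval_poly_part eval_poly_sinv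
  by (auto simp: free_alg_def)

lemma eval_poly_var: "eval_poly A s (var_poly x) = s x"
  by (simp add: var_poly_def eval_poly_single)

lemma subspace_center: "vs.subspace (alg_center A)"
proof -
  note c = subspace_carrier
  show ?thesis
    by (rule vs.subspaceI)
      (auto simp: alg_center_def mul_zero mul_add_left mul_add_right mul_scl_left mul_scl_right
        vs.subspace_0[OF c] vs.subspace_add[OF c] vs.subspace_scale[OF c])
qed

end

section \<open>Homomorphisms and the universal property of the free algebra\<close>

lemma var_poly_sym_skew:
  "var_poly (Y i j) \<in> sym_part free_alg j" "var_poly (Z i j) \<in> skew_part free_alg j"
  by (auto simp: sym_part_def skew_part_def sinv_var_poly)
    (auto simp: var_poly_def free_alg_def)

text \<open>A graded map commuting with the superinvolutions preserves their eigenspaces for the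
  eigenvalues 1 and -1.\<close>

lemma star_hom_sym_skew:
  assumes "star_algebra A" "star_algebra B" "star_hom A B h"
  shows "a \<in> sym_part A i \<Longrightarrow> h a \<in> sym_part B i"
    and "a \<in> skew_part A i \<Longrightarrow> h a \<in> skew_part B i"
proof -
  interpret A: star_algebra A by fact
  interpret B: star_algebra B by fact
  interpret VA: vector_space "scl A" by (rule A.vector_space)
  interpret VB: vector_space "scl B" by (rule B.vector_space)
  have p: "h a \<in> part B i" "h (sinv A a) = sinv B (h a)" "h (- a) = - h a"
    if "a \<in> part A i" for a
  proof -
    have "a \<in> alg_carrier A" using that by (rule A.part_carrier)
    \<comment> \<open>Compatibility with negation comes from the scalar -1.\<close>
    moreover from this have "h (scl A (- 1) a) = scl B (- 1) (h a)"
      using assms(3) unfolding star_hom_def by blast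
    ultimately show "h a \<in> part B i" "h (sinv A a) = sinv B (h a)" "h (- a) = - h a"
      using assms(3) that unfolding star_hom_def image_subset_iff by auto
  qed
  show "a \<in> sym_part A i \<Longrightarrow> h a \<in> sym_part B i"
    using p[of a] by (auto simp: sym_part_def)
  show "a \<in> skew_part A i \<Longrightarrow> h a \<in> skew_part B i"
    using p[of a] by (auto simp: skew_part_def)
qed

text \<open>The conditions on \<open>h\<close> speak only about the carrier of \<open>B\<close>.
  That \<open>g\<close> maps into it follows by splitting an element into homogeneous
  components.\<close>

lemma star_hom_compose:
  assumes "star_algebra A" "star_algebra B" "star_hom A B g" "star_hom B C h"
  shows "star_hom A C (h \<circ> g)"
proof -
  interpret A: star_algebra A by fact
  interpret B: star_algebra B by fact
  interpret VB: vector_space "scl B" by (rule B.vector_space)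
  have "g a \<in> alg_carrier B" if a: "a \<in> alg_carrier A" for a
  proof -
    obtain u v where uv: "a = u + v" "u \<in> part A 0" "v \<in> part A 1"
      using a unfolding alg_carrier_def by blast
    then have "g u \<in> part B 0" "g v \<in> part B 1" "g a = g u + g v"
      using assms(3) A.part_carrier[OF uv(2)] A.part_carrier[OF uv(3)]
      unfolding star_hom_def image_subset_iff by auto
    then show ?thesis unfolding alg_carrier_def by blast
  qed
  then show ?thesis
    using assms(3,4) unfolding star_hom_def by (simp add: image_subset_iff)
qed

text \<open>The converse passage to \<open>star_hom_eval_poly\<close>, from a homomorphism to a
  substitution.\<close>

lemma admissible_star_hom:
  assumes "star_algebra A" "star_hom free_alg A h"
  shows "admissible A (\<lambda>x. h (var_poly x))"
  unfolding admissible_def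
  using star_hom_sym_skew[OF star_algebra_free assms] var_poly_sym_skew by blast

text \<open>The uniqueness half of the universal property: multiplicativity determines
  \<open>h\<close> on nonempty words, and linearity then determines it on the carrier.\<close>

lemma star_hom_free_unique:
  assumes "star_algebra A" "star_hom free_alg A h" "f \<in> alg_carrier free_alg"
  shows "h f = eval_poly A (\<lambda>x. h (var_poly x)) f"
proof -
  interpret A: star_algebra A by fact
  interpret V: vector_space "scl A" by (rule A.vector_space)
  let ?s = "\<lambda>x. h (var_poly x)" and ?c = "alg_carrier free_alg"
  have add: "h (a + b) = h a + h b" if "a \<in> ?c" "b \<in> ?c" for a b
    using assms(2) that by (auto simp: star_hom_def)
  have scl: "h (scl free_alg k a) = scl A k (h a)" if "a \<in> ?c" for a k
    using assms(2) that by (auto simp: star_hom_def)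
  have mul: "h (a * b) = mul A (h a) (h b)" if "a \<in> ?c" "b \<in> ?c" for a b
    using assms(2) that by (auto simp: star_hom_def free_alg_def)
  have word: "h (Poly_Mapping.single w 1) = eval_word A ?s w" if "w \<noteq> []" for w
    using that
  proof (induction w rule: induct_list012)
    case (3 x y w)
    have "Poly_Mapping.single (x # y # w) 1 = var_poly x * Poly_Mapping.single (y # w) (1::'a)"
      by (simp add: var_poly_def mult_single plus_list_def)
    then show ?case
      using 3 by (simp add: mul alg_carrier_free var_poly_def lookup_single)
  qed (simp_all add: var_poly_def)
  have single: "h (Poly_Mapping.single w k) = scl A k (eval_word A ?s w)" if "w \<noteq> []" for w k
  proof -
    have "Poly_Mapping.single w k = scl free_alg k (Poly_Mapping.single w 1)"
      by (rule poly_mapping_eqI) (simp add: lookup_scl_free lookup_single when_def)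
    then show ?thesis
      using that by (simp add: scl word alg_carrier_free lookup_single)
  qed
  have zero: "h 0 = 0"
    using add[of 0 0] by (simp add: alg_carrier_free)
  \<comment> \<open>Excluding \<open>[]\<close> keeps every partial sum in the carrier, where
    \<open>h\<close> is known to be additive.\<close>
  have sum: "h (\<Sum>w\<in>S. Poly_Mapping.single w (k w)) = (\<Sum>w\<in>S. scl A (k w) (eval_word A ?s w))"
    if "finite S" "[] \<notin> S" for S k
    using that
  proof (induction S)
    case (insert w S)
    have "(\<Sum>w\<in>S. Poly_Mapping.single w (k w)) \<in> ?c"
      using insert by (auto simp: alg_carrier_free lookup_sum lookup_single when_def intro!: sum.neutral)
    moreover have "Poly_Mapping.single w (k w) \<in> ?c" and "w \<noteq> []"
      using insert by (auto simp: alg_carrier_free lookup_single)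
    ultimately show ?case
      using insert by (simp add: add single)
  qed (simp add: zero)
  have "h f = h (\<Sum>w\<in>Poly_Mapping.keys f. Poly_Mapping.single w (Poly_Mapping.lookup f w))"
    using poly_sum_single[of f] by simp
  also have "\<dots> = eval_poly A ?s f"
    using assms(3) by (subst sum) (auto simp: eval_poly_def alg_carrier_free in_keys_iff)
  finally show ?thesis .
qed

section \<open>Central polynomials and generated subspaces\<close>

text \<open>Linearity comes from that of the center. Invariance holds because an endomorphism
  followed by an admissible evaluation is again an admissible evaluation.\<close>

lemma T2_star_subspace_central:
  assumes "star_algebra A"
  shows "T2_star_subspace (central_star_polynomials A)"
  unfolding T2_star_subspace_def
proof (intro conjI allI impI)
  interpret A: star_algebra A by fact
  interpret V: vector_space "scl A" by (rule A.vector_space)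
  interpret F: star_algebra "free_alg :: ('a, var list \<Rightarrow>\<^sub>0 'a) superalg"
    by (rule star_algebra_free)
  interpret VF: vector_space "scl (free_alg :: ('a, var list \<Rightarrow>\<^sub>0 'a) superalg)"
    by (rule F.vector_space)
  show "central_star_polynomials A \<subseteq> alg_carrier free_alg"
    by (auto simp: central_star_polynomials_def)
  show "module.subspace (scl free_alg) (central_star_polynomials A)"
  proof (rule VF.subspaceI)
    show "0 \<in> central_star_polynomials A"
      using V.subspace_0[OF A.subspace_center] VF.subspace_0[OF F.subspace_carrier]
      by (simp add: central_star_polynomials_def eval_poly_def)
    show "f + g \<in> central_star_polynomials A"
      if "f \<in> central_star_polynomials A" "g \<in> central_star_polynomials A" for f g
      using that
      by (simp add: central_star_polynomials_def A.eval_poly_add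
          VF.subspace_add[OF F.subspace_carrier] V.subspace_add[OF A.subspace_center])
    show "scl free_alg k f \<in> central_star_polynomials A"
      if "f \<in> central_star_polynomials A" for k f
      using that
      by (simp add: central_star_polynomials_def A.eval_poly_scl
          VF.subspace_scale[OF F.subspace_carrier] V.subspace_scale[OF A.subspace_center])
  qed
  show "h ` central_star_polynomials A \<subseteq> central_star_polynomials A"
    if h: "star_hom free_alg free_alg h" for h
  proof (intro image_subsetI)
    fix f assume f: "f \<in> central_star_polynomials A"
    then have fc: "f \<in> alg_carrier free_alg" by (simp add: central_star_polynomials_def)
    \<comment> \<open>The endomorphism \<open>h\<close> is itself an evaluation in
      \<open>free_alg\<close>, and evaluations take values in the carrier.\<close>
    have "h f \<in> alg_carrier free_alg"
      using star_hom_free_unique[OF star_algebra_free h fc]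
        F.eval_poly_carrier[OF admissible_star_hom[OF star_algebra_free h]] by simp
    moreover have "eval_poly A s (h f) \<in> alg_center A" if s: "admissible A s" for s
    proof -
      \<comment> \<open>By uniqueness this composite is evaluation at the values it takes on the
        variables, so centrality of \<open>f\<close> applies.\<close>
      have hs: "star_hom free_alg A (eval_poly A s \<circ> h)"
        by (rule star_hom_compose[OF star_algebra_free star_algebra_free h A.star_hom_eval_poly[OF s]])
      show ?thesis
        using star_hom_free_unique[OF assms hs fc] admissible_star_hom[OF assms hs] f
        by (simp add: central_star_polynomials_def)
    qed
    ultimately show "h f \<in> central_star_polynomials A"
      by (simp add: central_star_polynomials_def)
  qed
qed

lemma T2_star_subspace_sym:
  assumes T: "T2_star_subspace T" "var_poly (Y 0 0) \<in> T" and p: "p \<in> sym_part free_alg 0"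
  shows "p \<in> T"
proof -
  interpret F: star_algebra "free_alg :: ('a, var list \<Rightarrow>\<^sub>0 'a) superalg"
    by (rule star_algebra_free)
  \<comment> \<open>The remaining variables go to \<open>0\<close>, which is both symmetric and skew
    in each degree.\<close>
  define s where "s x = (if x = Y 0 0 then p else 0)" for x
  have "admissible free_alg s"
    using p F.zero_part
    by (auto simp: admissible_def s_def sym_part_def skew_part_def F.sinv_zero)
  then have "eval_poly free_alg s ` T \<subseteq> T"
    using T(1) F.star_hom_eval_poly unfolding T2_star_subspace_def by blast
  moreover have "eval_poly free_alg s (var_poly (Y 0 0)) = p"
    by (simp add: F.eval_poly_var s_def)
  ultimately show ?thesis using T(2) by blast
qed

text \<open>This isolates what the argument takes from \<open>M11\<close>: the equality of
  \<open>alg_center A\<close> and \<open>sym_part A 0\<close>. Characteristic zero supplies the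
  factor \<open>1/2\<close> in the symmetrization.\<close>

lemma central_eq_hull_identities:
  fixes A :: "('f::field_char_0, 'a::ab_group_add) superalg"
  assumes "star_algebra A" and center: "alg_center A = sym_part A 0"
  shows "central_star_polynomials A =
    T2_star_subspace hull (insert (var_poly (Y 0 0)) (star_identities A))" (is "?C = _ hull ?G")
proof (rule antisym)
  interpret A: star_algebra A by fact
  interpret V: vector_space "scl A" by (rule A.vector_space)
  interpret F: star_algebra "free_alg :: ('f, var list \<Rightarrow>\<^sub>0 'f) superalg"
    by (rule star_algebra_free)
  interpret VF: vector_space "scl (free_alg :: ('f, var list \<Rightarrow>\<^sub>0 'f) superalg)"
    by (rule F.vector_space)
  \<comment> \<open>An admissible value of this variable lies in \<open>sym_part A 0\<close>, which
    is the center.\<close>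
  have "var_poly (Y 0 0) \<in> ?C"
    using var_poly_sym_skew(1)[of 0 0]
    by (auto simp: central_star_polynomials_def center A.eval_poly_var admissible_def sym_part_def
        intro: F.part_carrier)
  moreover have "star_identities A \<subseteq> ?C"
    using V.subspace_0[OF A.subspace_center]
    by (auto simp: star_identities_def central_star_polynomials_def)
  ultimately show "T2_star_subspace hull ?G \<subseteq> ?C"
    by (intro hull_minimal T2_star_subspace_central assms) auto
  show "?C \<subseteq> T2_star_subspace hull ?G"
  proof
    fix f assume f: "f \<in> ?C"
    then have fc: "f \<in> alg_carrier free_alg" by (simp add: central_star_polynomials_def)
    then obtain a b where ab: "f = a + b" "a \<in> part free_alg 0" "b \<in> part free_alg 1"
      unfolding alg_carrier_def by blast
    define p where "p = scl free_alg (1/2) (a + sinv free_alg a)"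
    have a': "sinv free_alg a \<in> part free_alg 0"
      using ab(2) F.sinv_part[of 0] by blast
    have c: "a \<in> alg_carrier free_alg" "sinv free_alg a \<in> alg_carrier free_alg"
      using ab(2) a' by (auto intro: F.part_carrier)
    have pp: "p \<in> part free_alg 0"
      unfolding p_def using ab(2) a'
      by (intro VF.subspace_scale VF.subspace_add F.part_subspace)
    have p: "p \<in> sym_part free_alg 0"
      using pp c
      by (simp add: sym_part_def p_def F.sinv_scl sinv_free_add F.sinv_sinv
          VF.subspace_add[OF F.subspace_carrier] add.commute)
    have "eval_poly A s (f - p) = 0" if s: "admissible A s" for s
    proof -
      let ?e = "eval_poly A s"
      have fs: "?e a + ?e b \<in> sym_part A 0"
        using f s ab(1) center by (auto simp: central_star_polynomials_def A.eval_poly_add)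
      have ea: "?e a \<in> part A 0" and eb: "?e b \<in> part A 1"
        using A.eval_poly_part[OF s] ab by auto
      \<comment> \<open>The central value and \<open>?e a\<close> are both even, so
        \<open>?e b\<close> is even as well as odd and must vanish.\<close>
      have "?e b = (?e a + ?e b) - ?e a" by simp
      also have "\<dots> \<in> part A 0"
        using fs ea by (intro V.subspace_diff A.part_subspace) (auto simp: sym_part_def)
      finally have b0: "?e b = 0" using eb A.part_Int by blast
      then have "sinv A (?e a) = ?e a" using fs by (simp add: sym_part_def)
      then have "?e p = scl A (1/2) (?e a + ?e a)"
        by (simp add: p_def A.eval_poly_scl A.eval_poly_add A.eval_poly_sinv[OF s])
      also have "\<dots> = ?e a"
        by (simp add: V.scale_right_distrib flip: V.scale_left_distrib)
      finally have "?e p = ?e f" using b0 ab(1) by (simp add: A.eval_poly_add)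
      moreover have "?e f = ?e (f - p) + ?e p"
        by (simp flip: A.eval_poly_add)
      ultimately show ?thesis by simp
    qed
    moreover have "f - p \<in> alg_carrier free_alg"
      by (rule VF.subspace_diff[OF F.subspace_carrier fc F.part_carrier[OF pp]])
    ultimately have q: "f - p \<in> star_identities A"
      by (simp add: star_identities_def)
    \<comment> \<open>The hull is an intersection, so membership is tested in each invariant
      subspace \<open>T\<close> containing the generators.\<close>
    have "f \<in> T" if T: "T2_star_subspace T" "?G \<subseteq> T" for T
    proof -
      have "p \<in> T" using T by (intro T2_star_subspace_sym[OF _ _ p]) auto
      moreover have "f - p \<in> T" using q T by auto
      moreover have "VF.subspace T" using T(1) by (simp add: T2_star_subspace_def)
      ultimately have "(f - p) + p \<in> T" using VF.subspace_add by blast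
      then show ?thesis by simp
    qed
    then show "f \<in> T2_star_subspace hull ?G"
      by (simp add: hull_def)
  qed
qed

section \<open>The center of the matrix algebra\<close>

text \<open>Both sides consist of the scalar matrices: on diagonal matrices the superinvolution
  swaps the two diagonal entries.\<close>

lemma alg_center_M11: "alg_center M11 = sym_part (M11 :: ('f::field, 'f^2^2) superalg) 0"
proof (intro set_eqI iffI)
  fix X :: "'f^2^2" assume "X \<in> alg_center M11"
  then have comm: "X ** E = E ** X" for E
    by (simp add: alg_center_def alg_carrier_M11) (simp add: M11_def)
  show "X \<in> sym_part M11 0"
    \<comment> \<open>Commuting with \<open>e11\<close> kills the off-diagonal entries; commuting
      with \<open>e12\<close> equates the diagonal ones.\<close>
    using comm[of "vector [vector [1, 0], vector [0, 0]]"]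
      comm[of "vector [vector [0, 1], vector [0, 0]]"]
    by (auto simp: sym_part_def M11_def vec_eq_iff forall_2 matrix_matrix_mult_def sum_2)
next
  fix X :: "'f^2^2" assume "X \<in> sym_part M11 0"
  then have "X \<in> part M11 0" "sinv M11 X $ 2 $ 2 = X $ 2 $ 2"
    by (simp_all add: sym_part_def)
  then have X: "X $ 1 $ 2 = 0" "X $ 2 $ 1 = 0" "X $ 2 $ 2 = X $ 1 $ 1"
    by (simp_all add: M11_def)
  have "X ** E = E ** X" for E
    by (simp add: vec_eq_iff forall_2 matrix_matrix_mult_def sum_2 X mult.commute)
  then show "X \<in> alg_center M11"
    by (simp add: alg_center_def alg_carrier_M11) (simp add: M11_def)
qed

theorem theorem5p3:
  shows "central_star_polynomials (M11 :: ('f::field_char_0, 'f^2^2) superalg) =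
         T2_star_subspace hull
           (insert (var_poly (Y 0 0)) (star_identities (M11 :: ('f, 'f^2^2) superalg)))"
  by (rule central_eq_hull_identities[OF star_algebra_M11 alg_center_M11])

end
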